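(* Semi-Baxter permutations and plane permutations are equinumerous: for every $n\geq 1$, the number $SB_n$ of semi-Baxter permutations of size $n$ equals the number of plane permutations of size $n$.
   Context: A permutation $\pi=\pi_1\cdots\pi_n$ of $\{1,\dots,n\}$ is semi-Baxter if there are no indices $i<j$ and $k>j+1$ with $\pi_{j+1}<\pi_i<\pi_k<\pi_j$ (avoidance of the vincular pattern $2413$ with $4,1$ adjacent). It is plane if there are no indices $i<j$ and $k>j+1$ with $\pi_{j}<\pi_i<\pi_k<\pi_{j+1}$ (avoidance of the vincular pattern $2143$ with $1,4$ adjacent). *)

theory Defs
  imports Main "HOL-Combinatorics.Permutations"
begin

text \<open>A permutation of \<open>{1..n}\<close> is a function \<open>\<pi>\<close> with \<open>\<pi> permutes {1..n}\<close>,
  and \<open>\<pi> i\<close> is the \<open>i\<close>-th letter of its one-line notation. Since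
  \<open>\<pi>\<close> then fixes all points outside \<open>{1..n}\<close>, such functions correspond
  bijectively to permutations of size \<open>n\<close>.\<close>

text \<open>Avoidance of the vincular pattern 2-41-3, the letters 4 and 1 being adjacent.\<close>

definition semi_baxter :: "nat \<Rightarrow> (nat \<Rightarrow> nat) \<Rightarrow> bool" where
  "semi_baxter n \<pi> \<longleftrightarrow> \<pi> permutes {1..n} \<and>
     \<not> (\<exists>i j k. 1 \<le> i \<and> i < j \<and> j + 1 < k \<and> k \<le> n \<and>
          \<pi> (j + 1) < \<pi> i \<and> \<pi> i < \<pi> k \<and> \<pi> k < \<pi> j)"

text \<open>Avoidance of the vincular pattern 2-14-3, the letters 1 and 4 being adjacent.\<close>

definition plane_perm :: "nat \<Rightarrow> (nat \<Rightarrow> nat) \<Rightarrow> bool" where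
  "plane_perm n \<pi> \<longleftrightarrow> \<pi> permutes {1..n} \<and>
     \<not> (\<exists>i j k. 1 \<le> i \<and> i < j \<and> j + 1 < k \<and> k \<le> n \<and>
          \<pi> j < \<pi> i \<and> \<pi> i < \<pi> k \<and> \<pi> k < \<pi> (j + 1))"

definition SB :: "nat \<Rightarrow> nat" where
  "SB n = card {\<pi>. semi_baxter n \<pi>}"

end

theory Submission imports Defs begin

text \<open>Both classes are grown by appending a last letter. Appending the value \<open>a\<close> to a permutation of
  size \<open>n\<close> raises the letters \<open>\<ge> a\<close> by one, and every permutation of size \<open>n + 1\<close> arises exactly once
  in this way. Call \<open>a\<close> an active site if the result stays in the class; deleting the last letter
  never creates a forbidden pattern, so the active sites describe the whole growth
  (\<open>sum_avoiders_Suc\<close>).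

  Split the active sites into those weakly below and those above the last letter, and let \<open>h\<close> and
  \<open>k\<close> be their numbers. After the insertion of \<open>a\<close>, only the adjacent pair formed by the old last
  letter and \<open>a\<close> can deactivate sites. For semi-Baxter permutations this happens if the new letter
  goes down; then the sites between the two letters disappear, except the one next to the new letter.
  So a pair \<open>(h, k)\<close> produces \<open>(1, k + 1), \<dots>, (h, k + 1)\<close> by descending steps and
  \<open>(h + 1, k), \<dots>, (h + k, 1)\<close> by ascending ones (\<open>semi_rule\<close>). For plane permutations it happens if
  the new letter goes up; then the sites between the two letters disappear, except the one next to the
  old letter, which is always active (\<open>plane_site_above_last\<close>). Counting as before shows that the
  reversed pairs \<open>(k, h)\<close> obey the very same rule (\<open>plane_rule\<close>). Both processes start from the pair
  \<open>(1, 1)\<close>, so the two label distributions agree for every size, and in particular so do the numbers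
  of permutations.\<close>

section \<open>Two patterns treated together\<close>

text \<open>In 2-41-3 and in 2-14-3 alike, the letters playing 2 and 3 lie between the two adjacent letters.
  The patterns differ only in whether the adjacent pair \<open>u v\<close> descends; the flag \<open>d\<close> records this, so
  that \<open>lo\<close> and \<open>hi\<close> pick the letters playing 1 and 4.\<close>

definition lo :: "bool \<Rightarrow> nat \<Rightarrow> nat \<Rightarrow> nat" where
  "lo d u v = (if d then v else u)"

definition hi :: "bool \<Rightarrow> nat \<Rightarrow> nat \<Rightarrow> nat" where
  "hi d u v = (if d then u else v)"

definition avoiders :: "bool \<Rightarrow> nat \<Rightarrow> (nat \<Rightarrow> nat) set" where
  "avoiders d n = {\<pi>. \<pi> permutes {1..n} \<and>
     (\<forall>i j k. 1 \<le> i \<longrightarrow> i < j \<longrightarrow> j + 1 < k \<longrightarrow> k \<le> n \<longrightarrow>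
        \<not> (lo d (\<pi> j) (\<pi> (j + 1)) < \<pi> i \<and> \<pi> i < \<pi> k \<and> \<pi> k < hi d (\<pi> j) (\<pi> (j + 1))))}"

lemma semi_baxter_avoiders: "{\<pi>. semi_baxter n \<pi>} = avoiders True n"
  unfolding semi_baxter_def avoiders_def lo_def hi_def by auto

lemma plane_perm_avoiders: "{\<pi>. plane_perm n \<pi>} = avoiders False n"
  unfolding plane_perm_def avoiders_def lo_def hi_def by auto

text \<open>The condition excludes the values \<open>a\<close> that would play 3 as a new last letter: since letters
  \<open>\<ge> a\<close> are raised, \<open>hi \<dots> \<ge> a\<close> means that the letter playing 4 ends up above \<open>a\<close>.\<close>

definition sites :: "bool \<Rightarrow> nat \<Rightarrow> (nat \<Rightarrow> nat) \<Rightarrow> nat set" where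
  "sites d n \<pi> = {a \<in> {1..Suc n}. \<forall>i j. 1 \<le> i \<longrightarrow> i < j \<longrightarrow> j < n \<longrightarrow>
        \<not> (lo d (\<pi> j) (\<pi> (j + 1)) < \<pi> i \<and> \<pi> i < a \<and> a \<le> hi d (\<pi> j) (\<pi> (j + 1)))}"

lemma finite_sites [simp]: "finite (sites d n \<pi>)"
  unfolding sites_def by simp

lemma sites_range: "a \<in> sites d n \<pi> \<Longrightarrow> a \<in> {1..Suc n}"
  unfolding sites_def by simp

section \<open>Appending a last letter\<close>

definition up :: "nat \<Rightarrow> nat \<Rightarrow> nat" where
  "up a x = (if x < a then x else Suc x)"

definition dn :: "nat \<Rightarrow> nat \<Rightarrow> nat" where
  "dn a b = (if b \<le> a then b else b - 1)"

text \<open>These equivalences transfer comparisons between a raised letter and a site of the longer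
  permutation to the shorter one.\<close>

lemma up_less_iff_dn: "up a x < b \<longleftrightarrow> x < dn a b"
  and le_up_iff_dn: "b \<le> up a x \<longleftrightarrow> dn a b \<le> x"
  unfolding up_def dn_def by auto

lemma up_less_up [simp]: "up a x < up a y \<longleftrightarrow> x < y"
  and up_eq_up [simp]: "up a x = up a y \<longleftrightarrow> x = y"
  and up_less_self [simp]: "up a x < a \<longleftrightarrow> x < a"
  and self_less_up [simp]: "a < up a x \<longleftrightarrow> a \<le> x"
  and up_neq_self [simp]: "up a x \<noteq> a"
  unfolding up_def by auto

lemma lo_up: "lo d (up a x) (up a y) = up a (lo d x y)"
  and hi_up: "hi d (up a x) (up a y) = up a (hi d x y)"
  unfolding lo_def hi_def by auto

lemma up_dn: "x \<noteq> a \<Longrightarrow> up a (dn a x) = x"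
  unfolding up_def dn_def by auto

definition ins :: "nat \<Rightarrow> (nat \<Rightarrow> nat) \<Rightarrow> nat \<Rightarrow> nat \<Rightarrow> nat" where
  "ins n \<pi> a i = (if i = Suc n then a else if i \<in> {1..n} then up a (\<pi> i) else i)"

lemma ins_last [simp]: "ins n \<pi> a (Suc n) = a"
  and ins_le: "1 \<le> i \<Longrightarrow> i \<le> n \<Longrightarrow> ins n \<pi> a i = up a (\<pi> i)"
  unfolding ins_def by auto

lemma permutes_atLeastAtMost_nat:
  assumes "inj_on p {1..n}" and "p ` {1..n} \<subseteq> {1..n}" and "\<And>i. i \<notin> {1..n} \<Longrightarrow> p i = i"
  shows "p permutes {1..n::nat}"
  using assms by (intro bij_imp_permutes) (auto simp: bij_betw_def endo_inj_surj)

lemma ins_permutes: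
  assumes p: "\<pi> permutes {1..n}" and a: "a \<in> {1..Suc n}"
  shows "ins n \<pi> a permutes {1..Suc n}"
proof (rule permutes_atLeastAtMost_nat)
  have inj: "\<pi> i = \<pi> j \<longleftrightarrow> i = j" for i j
    using permutes_inj[OF p] by (auto dest: injD)
  show "inj_on (ins n \<pi> a) {1..Suc n}"
    by (auto simp: inj_on_def ins_def inj up_neq_self[symmetric] split: if_splits)
  show "ins n \<pi> a ` {1..Suc n} \<subseteq> {1..Suc n}"
  proof
    fix y assume "y \<in> ins n \<pi> a ` {1..Suc n}"
    then obtain i where i: "i \<in> {1..Suc n}" "y = ins n \<pi> a i" by auto
    show "y \<in> {1..Suc n}"
    proof (cases "i = Suc n")
      case True
      then show ?thesis using a i by simp
    next
      case False
      then have "\<pi> i \<in> {1..n}" using i permutes_in_image[OF p, of i] by auto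
      then show ?thesis using i False by (auto simp: ins_def up_def)
    qed
  qed
qed (auto simp: ins_def)

lemma ins_inj:
  assumes "\<pi> permutes {1..n}" "\<rho> permutes {1..n}" and eq: "ins n \<pi> a = ins n \<rho> b"
  shows "\<pi> = \<rho> \<and> a = b"
proof -
  have ab: "a = b" using fun_cong[OF eq, of "Suc n"] by simp
  have "\<pi> i = \<rho> i" for i
  proof (cases "i \<in> {1..n}")
    case True
    then show ?thesis using fun_cong[OF eq, of i] ab by (simp add: ins_le)
  next
    case False
    then show ?thesis using assms(1,2) by (simp add: permutes_not_in)
  qed
  then show ?thesis using ab by auto
qed

lemma ins_surj:
  assumes s: "\<sigma> permutes {1..Suc n}"
  obtains \<pi> a where "\<pi> permutes {1..n}" "a \<in> {1..Suc n}" "\<sigma> = ins n \<pi> a"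
proof
  let ?a = "\<sigma> (Suc n)"
  let ?p = "\<lambda>i. if i \<in> {1..n} then dn ?a (\<sigma> i) else i"
  have inj: "\<sigma> i = \<sigma> j \<longleftrightarrow> i = j" for i j
    using permutes_inj[OF s] by (auto dest: injD)
  have up: "up ?a (?p i) = \<sigma> i" if "i \<in> {1..n}" for i
    using that by (simp add: up_dn inj)
  show a: "?a \<in> {1..Suc n}" using permutes_in_image[OF s, of "Suc n"] by simp
  show "?p permutes {1..n}"
  proof (rule permutes_atLeastAtMost_nat)
    show "inj_on ?p {1..n}"
      by (rule inj_onI) (metis up inj)
    show "?p ` {1..n} \<subseteq> {1..n}"
    proof
      fix y assume "y \<in> ?p ` {1..n}"
      then obtain i where i: "i \<in> {1..n}" "y = ?p i" by auto
      have "up ?a y \<in> {1..Suc n}" "up ?a y \<noteq> ?a"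
        using up[OF i(1)] i permutes_in_image[OF s, of i] by auto
      with a show "y \<in> {1..n}" by (auto simp: up_def split: if_splits)
    qed
  qed auto
  show "\<sigma> = ins n ?p ?a"
  proof
    fix i show "\<sigma> i = ins n ?p ?a i"
    proof (cases "i \<in> {1..n}")
      case True
      then show ?thesis using up[OF True] by (simp add: ins_def)
    next
      case False
      then show ?thesis using permutes_not_in[OF s, of i] by (auto simp: ins_def)
    qed
  qed
qed

text \<open>A forbidden pattern of the extended permutation either lies in the old part, where raising
  preserves relative order, or uses the new letter, which being last can only play 3.\<close>

lemma ins_avoiders_iff:
  assumes p: "\<pi> permutes {1..n}" and a: "a \<in> {1..Suc n}"
  shows "ins n \<pi> a \<in> avoiders d (Suc n) \<longleftrightarrow> \<pi> \<in> avoiders d n \<and> a \<in> sites d n \<pi>"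
proof -
  let ?s = "ins n \<pi> a"
  let ?bad = "\<lambda>\<sigma> i j k. lo d (\<sigma> j) (\<sigma> (j + 1)) < \<sigma> i \<and> \<sigma> i < \<sigma> k \<and> \<sigma> k < hi d (\<sigma> j) (\<sigma> (j + 1))"
  have old: "?bad ?s i j k \<longleftrightarrow> ?bad \<pi> i j k"
    if "1 \<le> i" "i < j" "j + 1 < k" "k \<le> n" for i j k
    using that by (simp add: ins_le lo_up hi_up)
  have new: "?bad ?s i j (Suc n) \<longleftrightarrow>
      lo d (\<pi> j) (\<pi> (j + 1)) < \<pi> i \<and> \<pi> i < a \<and> a \<le> hi d (\<pi> j) (\<pi> (j + 1))"
    if "1 \<le> i" "i < j" "j < n" for i j
    using that by (simp add: ins_le lo_up hi_up)
  have split: "(\<forall>i j k. 1 \<le> i \<longrightarrow> i < j \<longrightarrow> j + 1 < k \<longrightarrow> k \<le> Suc n \<longrightarrow> Q i j k) \<longleftrightarrow>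
      (\<forall>i j k. 1 \<le> i \<longrightarrow> i < j \<longrightarrow> j + 1 < k \<longrightarrow> k \<le> n \<longrightarrow> Q i j k) \<and>
      (\<forall>i j. 1 \<le> i \<longrightarrow> i < j \<longrightarrow> j < n \<longrightarrow> Q i j (Suc n))"
      (is "?A \<longleftrightarrow> ?B \<and> ?C") for Q :: "nat \<Rightarrow> nat \<Rightarrow> nat \<Rightarrow> bool"
  proof (intro iffI conjI)
    show ?C if ?A using that by fastforce
    show ?A if "?B \<and> ?C"
    proof (intro allI impI)
      fix i j k assume "1 \<le> i" "i < j" "j + 1 < k" "k \<le> Suc n"
      then show "Q i j k" using that by (cases "k = Suc n") auto
    qed
  qed auto
  have "ins n \<pi> a \<in> avoiders d (Suc n) \<longleftrightarrow>
      (\<forall>i j k. 1 \<le> i \<longrightarrow> i < j \<longrightarrow> j + 1 < k \<longrightarrow> k \<le> Suc n \<longrightarrow> \<not> ?bad ?s i j k)"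
    using ins_permutes[OF p a] by (simp add: avoiders_def)
  also have "\<dots> \<longleftrightarrow>
      (\<forall>i j k. 1 \<le> i \<longrightarrow> i < j \<longrightarrow> j + 1 < k \<longrightarrow> k \<le> n \<longrightarrow> \<not> ?bad ?s i j k) \<and>
      (\<forall>i j. 1 \<le> i \<longrightarrow> i < j \<longrightarrow> j < n \<longrightarrow> \<not> ?bad ?s i j (Suc n))"
    by (rule split)
  also have "\<dots> \<longleftrightarrow> \<pi> \<in> avoiders d n \<and> a \<in> sites d n \<pi>"
    using p a old new by (simp add: avoiders_def sites_def)
  finally show ?thesis .
qed

lemma finite_avoiders [simp]: "finite (avoiders d n)"
  by (rule finite_subset[OF _ finite_permutations[of "{1..n}"]]) (auto simp: avoiders_def)

lemma sum_avoiders_Suc: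
  "(\<Sum>\<sigma>\<in>avoiders d (Suc n). G \<sigma>) = (\<Sum>\<pi>\<in>avoiders d n. \<Sum>a\<in>sites d n \<pi>. G (ins n \<pi> a))"
proof -
  let ?S = "Sigma (avoiders d n) (sites d n)"
  have perm: "\<pi> permutes {1..m}" if "\<pi> \<in> avoiders d m" for \<pi> m
    using that by (simp add: avoiders_def)
  have "inj_on (\<lambda>(\<pi>, a). ins n \<pi> a) ?S"
    using ins_inj perm by (fastforce simp: inj_on_def)
  moreover have "(\<lambda>(\<pi>, a). ins n \<pi> a) ` ?S = avoiders d (Suc n)" (is "?L = ?R")
  proof
    show "?L \<subseteq> ?R" using ins_avoiders_iff[OF perm sites_range] by fastforce
    show "?R \<subseteq> ?L"
    proof
      fix \<sigma> assume \<sigma>: "\<sigma> \<in> ?R"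
      obtain \<pi> a where pa: "\<pi> permutes {1..n}" "a \<in> {1..Suc n}" "\<sigma> = ins n \<pi> a"
        using ins_surj[OF perm[OF \<sigma>]] .
      then have "(\<pi>, a) \<in> ?S" using ins_avoiders_iff[OF pa(1,2)] \<sigma> by simp
      then show "\<sigma> \<in> ?L" using pa(3) by force
    qed
  qed
  ultimately have "(\<Sum>\<sigma>\<in>avoiders d (Suc n). G \<sigma>) = (\<Sum>(\<pi>, a)\<in>?S. G (ins n \<pi> a))"
    using sum.reindex[of "\<lambda>(\<pi>, a). ins n \<pi> a" ?S G] by (simp add: case_prod_unfold comp_def)
  then show ?thesis by (simp add: sum.Sigma)
qed

section \<open>How the active sites change\<close>

text \<open>Obstructions to a site of the extended permutation come in two kinds: those in the old part
  already obstruct the site \<open>dn a b\<close> from which \<open>b\<close> arises, and the new ones are those whose adjacent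
  pair ends in the new letter.\<close>

lemma sites_ins_iff:
  assumes "1 \<le> n" and a: "a \<in> {1..Suc n}"
  shows "b \<in> sites d (Suc n) (ins n \<pi> a) \<longleftrightarrow> b \<in> {1..Suc (Suc n)} \<and> dn a b \<in> sites d n \<pi> \<and>
     \<not> (\<exists>i. 1 \<le> i \<and> i < n \<and> lo d (up a (\<pi> n)) a < up a (\<pi> i) \<and> up a (\<pi> i) < b \<and>
            b \<le> hi d (up a (\<pi> n)) a)"
    (is "_ \<longleftrightarrow> _ \<and> _ \<and> ?new")
proof -
  let ?s = "ins n \<pi> a"
  let ?bad = "\<lambda>\<sigma> c i j. lo d (\<sigma> j) (\<sigma> (j + 1)) < \<sigma> i \<and> \<sigma> i < c \<and> c \<le> hi d (\<sigma> j) (\<sigma> (j + 1))"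
  have old: "?bad ?s b i j \<longleftrightarrow> ?bad \<pi> (dn a b) i j" if "1 \<le> i" "i < j" "j < n" for i j
    using that by (simp add: ins_le lo_up hi_up up_less_iff_dn[of a _ b] le_up_iff_dn[of b])
  have new: "(\<forall>i. 1 \<le> i \<longrightarrow> i < n \<longrightarrow> \<not> ?bad ?s b i n) \<longleftrightarrow> ?new"
    using assms by (auto simp: ins_le)
  have range: "dn a b \<in> {1..Suc n}" if "b \<in> {1..Suc (Suc n)}"
    using that a by (auto simp: dn_def)
  have split: "b \<in> R \<and> (\<forall>i j. 1 \<le> i \<longrightarrow> i < j \<longrightarrow> j < Suc n \<longrightarrow> Q i j) \<longleftrightarrow>
      b \<in> R \<and> (\<forall>i j. 1 \<le> i \<longrightarrow> i < j \<longrightarrow> j < n \<longrightarrow> Q i j) \<and>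
      (\<forall>i. 1 \<le> i \<longrightarrow> i < n \<longrightarrow> Q i n)" for Q :: "nat \<Rightarrow> nat \<Rightarrow> bool" and R
    by (auto simp: less_Suc_eq)
  have "b \<in> sites d (Suc n) ?s \<longleftrightarrow> b \<in> {1..Suc (Suc n)} \<and>
      (\<forall>i j. 1 \<le> i \<longrightarrow> i < j \<longrightarrow> j < Suc n \<longrightarrow> \<not> ?bad ?s b i j)"
    by (simp add: sites_def)
  also have "\<dots> \<longleftrightarrow> b \<in> {1..Suc (Suc n)} \<and>
      (\<forall>i j. 1 \<le> i \<longrightarrow> i < j \<longrightarrow> j < n \<longrightarrow> \<not> ?bad ?s b i j) \<and>
      (\<forall>i. 1 \<le> i \<longrightarrow> i < n \<longrightarrow> \<not> ?bad ?s b i n)"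
    by (rule split)
  also have "\<dots> \<longleftrightarrow> b \<in> {1..Suc (Suc n)} \<and>
      (\<forall>i j. 1 \<le> i \<longrightarrow> i < j \<longrightarrow> j < n \<longrightarrow> \<not> ?bad \<pi> (dn a b) i j) \<and> ?new"
    using old new by simp
  also have "\<dots> \<longleftrightarrow> b \<in> {1..Suc (Suc n)} \<and> dn a b \<in> sites d n \<pi> \<and> ?new"
    using range by (auto simp: sites_def)
  finally show ?thesis .
qed

lemma value_before_last:
  assumes p: "\<pi> permutes {1..n::nat}" and x: "x \<in> {1..n}" "x \<noteq> \<pi> n"
  obtains i where "1 \<le> i" "i < n" "\<pi> i = x"
proof -
  obtain i where i: "i \<in> {1..n}" "\<pi> i = x" using permutes_image[OF p] x(1) by (metis imageE)
  with x(2) have "i \<noteq> n" by auto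
  with i show ?thesis by (intro that[of i]) auto
qed

text \<open>If the new letter \<open>a\<close> lies below the last letter, then the letter that was \<open>a\<close> before raising
  precedes the descent and plays 2 in a pattern 2-41. It obstructs every site from \<open>a + 2\<close> up to the
  raised last letter, and larger choices of 2 obstruct fewer sites.\<close>

lemma semi_sites_ins:
  assumes p: "\<pi> permutes {1..n}" and n: "1 \<le> n" and a: "a \<in> {1..Suc n}"
  shows "b \<in> sites True (Suc n) (ins n \<pi> a) \<longleftrightarrow>
    b \<in> {1..Suc (Suc n)} \<and> dn a b \<in> sites True n \<pi> \<and> \<not> (Suc a < b \<and> b \<le> up a (\<pi> n))"
proof -
  have "(\<exists>i. 1 \<le> i \<and> i < n \<and> a < up a (\<pi> i) \<and> up a (\<pi> i) < b \<and> b \<le> up a (\<pi> n)) \<longleftrightarrow>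
      Suc a < b \<and> b \<le> up a (\<pi> n)" (is "?L \<longleftrightarrow> ?R")
  proof
    assume ?R
    moreover from this have "a < \<pi> n" by (auto simp: up_def split: if_splits)
    moreover from this have "a \<in> {1..n}"
      using a permutes_in_image[OF p, of n] n by auto
    ultimately obtain i where "1 \<le> i" "i < n" "\<pi> i = a"
      using value_before_last[OF p, of a] by auto
    with \<open>?R\<close> show ?L by (intro exI[of _ i]) (simp add: up_def)
  next
    assume ?L
    then show ?R by (auto simp: up_def split: if_splits)
  qed
  then show ?thesis
    unfolding sites_ins_iff[OF n a] by (simp add: lo_def hi_def)
qed

text \<open>Dually, if \<open>a\<close> lies above the last letter, the letter one above the last letter is the most
  obstructive choice of 2 in a pattern 2-14.\<close>

lemma plane_sites_ins:
  assumes p: "\<pi> permutes {1..n}" and n: "1 \<le> n" and a: "a \<in> {1..Suc n}"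
  shows "b \<in> sites False (Suc n) (ins n \<pi> a) \<longleftrightarrow>
    b \<in> {1..Suc (Suc n)} \<and> dn a b \<in> sites False n \<pi> \<and> \<not> (Suc (\<pi> n) < b \<and> b \<le> a)"
proof -
  have "(\<exists>i. 1 \<le> i \<and> i < n \<and> up a (\<pi> n) < up a (\<pi> i) \<and> up a (\<pi> i) < b \<and> b \<le> a) \<longleftrightarrow>
      Suc (\<pi> n) < b \<and> b \<le> a" (is "?L \<longleftrightarrow> ?R")
  proof
    assume ?R
    moreover from this have "Suc (\<pi> n) \<in> {1..n}" using a by auto
    then obtain i where "1 \<le> i" "i < n" "\<pi> i = Suc (\<pi> n)"
      using value_before_last[OF p, of "Suc (\<pi> n)"] by auto
    ultimately show ?L by (intro exI[of _ i]) (auto simp: up_def)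
  next
    assume ?L
    then show ?R by (auto simp: up_def split: if_splits)
  qed
  then show ?thesis
    unfolding sites_ins_iff[OF n a] by (simp add: lo_def hi_def)
qed

text \<open>If a letter just above the last one is appended and plays 3 in a pattern, then the last letter
  can play 3 instead, so the pattern was there before. The site just below the last letter need not
  be active, because the last letter may play 4.\<close>

lemma plane_site_above_last:
  assumes \<pi>: "\<pi> \<in> avoiders False n" and n: "1 \<le> n"
  shows "Suc (\<pi> n) \<in> sites False n \<pi>"
proof -
  have p: "\<pi> permutes {1..n}" using \<pi> by (simp add: avoiders_def)
  have avoid: "\<not> (\<pi> j < \<pi> i \<and> \<pi> i < \<pi> k \<and> \<pi> k < \<pi> (j + 1))"
    if "1 \<le> i" "i < j" "j + 1 < k" "k \<le> n" for i j k
    using \<pi> that by (simp add: avoiders_def lo_def hi_def)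
  have "\<not> (\<pi> j < \<pi> i \<and> \<pi> i < Suc (\<pi> n) \<and> Suc (\<pi> n) \<le> \<pi> (j + 1))"
    if ij: "1 \<le> i" "i < j" "j < n" for i j
  proof
    assume *: "\<pi> j < \<pi> i \<and> \<pi> i < Suc (\<pi> n) \<and> Suc (\<pi> n) \<le> \<pi> (j + 1)"
    have "\<pi> i \<noteq> \<pi> n" using ij by (simp add: inj_eq[OF permutes_inj[OF p]])
    with * have "\<pi> i < \<pi> n" "\<pi> n < \<pi> (j + 1)" by auto
    moreover from this have "j + 1 \<noteq> n" by auto
    ultimately show False using avoid[of i j n] ij * by simp
  qed
  moreover have "\<pi> n \<in> {1..n}" using permutes_in_image[OF p, of n] n by auto
  ultimately show ?thesis by (auto simp: sites_def lo_def hi_def)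
qed

section \<open>The common succession rule\<close>

definition low :: "bool \<Rightarrow> nat \<Rightarrow> (nat \<Rightarrow> nat) \<Rightarrow> nat set" where
  "low d n \<pi> = {b \<in> sites d n \<pi>. b \<le> \<pi> n}"

definition high :: "bool \<Rightarrow> nat \<Rightarrow> (nat \<Rightarrow> nat) \<Rightarrow> nat set" where
  "high d n \<pi> = {b \<in> sites d n \<pi>. \<pi> n < b}"

lemma finite_low [simp]: "finite (low d n \<pi>)"
  and finite_high [simp]: "finite (high d n \<pi>)"
  by (simp_all add: low_def high_def)

lemma sum_sites_split:
  "(\<Sum>a\<in>sites d n \<pi>. F a) = (\<Sum>a\<in>low d n \<pi>. F a) + (\<Sum>a\<in>high d n \<pi>. F a :: nat)"
proof -
  have "sites d n \<pi> = low d n \<pi> \<union> high d n \<pi>" "low d n \<pi> \<inter> high d n \<pi> = {}"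
    by (auto simp: low_def high_def)
  then show ?thesis by (simp add: sum.union_disjoint)
qed

definition succession :: "(nat \<Rightarrow> nat \<Rightarrow> nat) \<Rightarrow> nat \<Rightarrow> nat \<Rightarrow> nat" where
  "succession g h k = (\<Sum>s=1..h. g s (k + 1)) + (\<Sum>t=1..k. g (h + t) (k + 1 - t))"

lemma sum_rank_le:
  fixes A :: "nat set"
  assumes "finite A"
  shows "(\<Sum>a\<in>A. F (card {b \<in> A. b \<le> a})) = (\<Sum>s=1..card A. F s)"
proof -
  let ?r = "\<lambda>a. card {b \<in> A. b \<le> a}"
  have less: "?r a < ?r c" if "a \<in> A" "c \<in> A" "a < c" for a c
  proof (rule psubset_card_mono)
    show "{b \<in> A. b \<le> a} \<subset> {b \<in> A. b \<le> c}" using that by force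
  qed (use assms in simp)
  then have inj: "inj_on ?r A"
    by (intro linorder_inj_onI) (use less in fastforce)+
  have "?r ` A \<subseteq> {1..card A}"
  proof (rule image_subsetI)
    fix a assume "a \<in> A"
    then have "card {b \<in> A. b \<le> a} > 0" using assms by (subst card_gt_0_iff) auto
    moreover have "card {b \<in> A. b \<le> a} \<le> card A" using assms by (intro card_mono) auto
    ultimately show "?r a \<in> {1..card A}" by simp
  qed
  then have "?r ` A = {1..card A}"
    using card_image[OF inj] by (intro card_subset_eq) auto
  then show ?thesis using sum.reindex[OF inj, of F] by simp
qed

lemma card_le_ge:
  fixes A :: "nat set"
  assumes "finite A" "a \<in> A"
  shows "card {b \<in> A. b \<le> a} + card {b \<in> A. a \<le> b} = Suc (card A)"
proof -
  have "{b \<in> A. b \<le> a} \<union> {b \<in> A. a \<le> b} = A" "{b \<in> A. b \<le> a} \<inter> {b \<in> A. a \<le> b} = {a}"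
    using assms by auto
  then show ?thesis using card_Un_Int[of "{b \<in> A. b \<le> a}" "{b \<in> A. a \<le> b}"] assms by simp
qed

lemma sum_rank_ge:
  fixes A :: "nat set"
  assumes "finite A"
  shows "(\<Sum>a\<in>A. F (card {b \<in> A. a \<le> b})) = (\<Sum>s=1..card A. F s)"
proof -
  have "(\<Sum>a\<in>A. F (card {b \<in> A. a \<le> b})) = (\<Sum>a\<in>A. F (Suc (card A) - card {b \<in> A. b \<le> a}))"
  proof (intro sum.cong refl)
    fix a assume "a \<in> A"
    then have "card {b \<in> A. a \<le> b} = Suc (card A) - card {b \<in> A. b \<le> a}"
      using card_le_ge[OF assms, of a] by linarith
    then show "F (card {b \<in> A. a \<le> b}) = F (Suc (card A) - card {b \<in> A. b \<le> a})" by simp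
  qed
  also have "\<dots> = (\<Sum>s=1..card A. F (Suc (card A) - s))"
    by (rule sum_rank_le[OF assms])
  also have "\<dots> = (\<Sum>s=1..card A. F s)"
    by (rule sum.reindex_bij_witness[of _ "\<lambda>s. Suc (card A) - s" "\<lambda>s. Suc (card A) - s"]) auto
  finally show ?thesis .
qed

text \<open>Membership of a site \<open>> a\<close> of the extended permutation is a condition on its predecessor, so
  the sites above the new letter form an image under \<open>Suc\<close>.\<close>

lemma high_ins_Suc_image:
  assumes "\<And>b. b \<in> sites d (Suc n) (ins n \<pi> a) \<longleftrightarrow>
      b \<in> {1..Suc (Suc n)} \<and> dn a b \<in> sites d n \<pi> \<and> \<not> P b"
  shows "high d (Suc n) (ins n \<pi> a) = Suc ` {b \<in> sites d n \<pi>. a \<le> b \<and> \<not> P (Suc b)}"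
proof (rule set_eqI)
  fix b
  show "b \<in> high d (Suc n) (ins n \<pi> a) \<longleftrightarrow>
    b \<in> Suc ` {b \<in> sites d n \<pi>. a \<le> b \<and> \<not> P (Suc b)}"
    using sites_range[of _ d n \<pi>] by (cases b) (auto simp: high_def assms dn_def)
qed

lemma low_ins:
  assumes "\<And>b. b \<in> sites d (Suc n) (ins n \<pi> a) \<longleftrightarrow>
      b \<in> {1..Suc (Suc n)} \<and> dn a b \<in> sites d n \<pi> \<and> \<not> P b"
  shows "low d (Suc n) (ins n \<pi> a) = {b \<in> sites d n \<pi>. b \<le> a \<and> \<not> P b}"
proof (rule set_eqI)
  fix b
  show "b \<in> low d (Suc n) (ins n \<pi> a) \<longleftrightarrow> b \<in> {b \<in> sites d n \<pi>. b \<le> a \<and> \<not> P b}"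
    using sites_range[of b d n \<pi>] by (auto simp: low_def assms dn_def)
qed

lemma semi_rule:
  assumes \<pi>: "\<pi> \<in> avoiders True n" and n: "1 \<le> n"
  shows "(\<Sum>a\<in>sites True n \<pi>. g (card (low True (Suc n) (ins n \<pi> a))) (card (high True (Suc n) (ins n \<pi> a))))
    = succession g (card (low True n \<pi>)) (card (high True n \<pi>))"
proof -
  let ?S = "sites True n \<pi>" and ?A = "low True n \<pi>" and ?B = "high True n \<pi>"
  let ?A' = "\<lambda>a. low True (Suc n) (ins n \<pi> a)" and ?B' = "\<lambda>a. high True (Suc n) (ins n \<pi> a)"
  have p: "\<pi> permutes {1..n}" using \<pi> by (simp add: avoiders_def)
  note A' = low_ins[OF semi_sites_ins[OF p n sites_range]]
    and B' = high_ins_Suc_image[OF semi_sites_ins[OF p n sites_range]]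
  have down: "card (?A' a) = card {b \<in> ?A. b \<le> a} \<and> card (?B' a) = card ?B + 1" if a: "a \<in> ?A" for a
  proof
    have aS: "a \<in> ?S" "a \<le> \<pi> n" using a by (auto simp: low_def)
    have "?A' a = {b \<in> ?A. b \<le> a}" unfolding A'[OF aS(1)] using aS by (auto simp: low_def)
    then show "card (?A' a) = card {b \<in> ?A. b \<le> a}" by simp
    have "?B' a = Suc ` insert a ?B"
      unfolding B'[OF aS(1)] using aS by (intro arg_cong[where f = "image Suc"]) (auto simp: high_def up_def)
    moreover have "a \<notin> ?B" using aS by (simp add: high_def)
    ultimately show "card (?B' a) = card ?B + 1" by (simp only: card_image inj_Suc) simp
  qed
  have upward: "card (?A' a) = card ?A + card {b \<in> ?B. b \<le> a} \<and>
      card (?B' a) = card ?B + 1 - card {b \<in> ?B. b \<le> a}" if a: "a \<in> ?B" for a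
  proof
    have aS: "a \<in> ?S" "\<pi> n < a" using a by (auto simp: high_def)
    have "?A' a = ?A \<union> {b \<in> ?B. b \<le> a}" unfolding A'[OF aS(1)] using aS by (auto simp: low_def high_def)
    moreover have "?A \<inter> {b \<in> ?B. b \<le> a} = {}" by (auto simp: low_def high_def)
    ultimately show "card (?A' a) = card ?A + card {b \<in> ?B. b \<le> a}"
      by (simp add: card_Un_disjoint)
    have "?B' a = Suc ` {b \<in> ?B. a \<le> b}"
      unfolding B'[OF aS(1)] using aS by (intro arg_cong[where f = "image Suc"]) (auto simp: high_def up_def)
    then have "card (?B' a) = card {b \<in> ?B. a \<le> b}" by (simp add: card_image)
    then show "card (?B' a) = card ?B + 1 - card {b \<in> ?B. b \<le> a}"
      using card_le_ge[of ?B a] a by simp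
  qed
  have "(\<Sum>a\<in>?S. g (card (?A' a)) (card (?B' a))) =
      (\<Sum>a\<in>?A. g (card {b \<in> ?A. b \<le> a}) (card ?B + 1)) +
      (\<Sum>a\<in>?B. g (card ?A + card {b \<in> ?B. b \<le> a}) (card ?B + 1 - card {b \<in> ?B. b \<le> a}))"
    unfolding sum_sites_split using down upward by simp
  also have "\<dots> = succession g (card ?A) (card ?B)"
    unfolding succession_def
    using sum_rank_le[of ?A "\<lambda>s. g s (card ?B + 1)"]
      sum_rank_le[of ?B "\<lambda>t. g (card ?A + t) (card ?B + 1 - t)"] by simp
  finally show ?thesis .
qed

text \<open>The rule for \<open>(high, low)\<close> instead of \<open>(low, high)\<close>. Accordingly the sites are ranked from the
  top, and ascending insertions supply the first sum of the rule.\<close>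

lemma plane_rule:
  assumes \<pi>: "\<pi> \<in> avoiders False n" and n: "1 \<le> n"
  shows "(\<Sum>a\<in>sites False n \<pi>. g (card (high False (Suc n) (ins n \<pi> a))) (card (low False (Suc n) (ins n \<pi> a))))
    = succession g (card (high False n \<pi>)) (card (low False n \<pi>))"
proof -
  let ?S = "sites False n \<pi>" and ?A = "low False n \<pi>" and ?B = "high False n \<pi>"
  let ?A' = "\<lambda>a. low False (Suc n) (ins n \<pi> a)" and ?B' = "\<lambda>a. high False (Suc n) (ins n \<pi> a)"
  have p: "\<pi> permutes {1..n}" using \<pi> by (simp add: avoiders_def)
  note A' = low_ins[OF plane_sites_ins[OF p n sites_range]]
    and B' = high_ins_Suc_image[OF plane_sites_ins[OF p n sites_range]]
  have down: "card (?B' a) = card ?B + card {b \<in> ?A. a \<le> b} \<and>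
      card (?A' a) = card ?A + 1 - card {b \<in> ?A. a \<le> b}" if a: "a \<in> ?A" for a
  proof
    have aS: "a \<in> ?S" "a \<le> \<pi> n" using a by (auto simp: low_def)
    have "?A' a = {b \<in> ?A. b \<le> a}" unfolding A'[OF aS(1)] using aS by (auto simp: low_def)
    then show "card (?A' a) = card ?A + 1 - card {b \<in> ?A. a \<le> b}"
      using card_le_ge[of ?A a] a by simp
    have "?B' a = Suc ` (?B \<union> {b \<in> ?A. a \<le> b})"
      unfolding B'[OF aS(1)] using aS by (intro arg_cong[where f = "image Suc"]) (auto simp: high_def low_def)
    moreover have "?B \<inter> {b \<in> ?A. a \<le> b} = {}" by (auto simp: low_def high_def)
    ultimately show "card (?B' a) = card ?B + card {b \<in> ?A. a \<le> b}"
      by (simp only: card_image inj_Suc) (simp add: card_Un_disjoint)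
  qed
  have upward: "card (?B' a) = card {b \<in> ?B. a \<le> b} \<and> card (?A' a) = card ?A + 1"
    if a: "a \<in> ?B" for a
  proof
    have aS: "a \<in> ?S" "\<pi> n < a" using a by (auto simp: high_def)
    have "?A' a = insert (Suc (\<pi> n)) ?A"
      unfolding A'[OF aS(1)] using aS plane_site_above_last[OF \<pi> n] by (auto simp: low_def)
    moreover have "Suc (\<pi> n) \<notin> ?A" by (simp add: low_def)
    ultimately show "card (?A' a) = card ?A + 1" by simp
    have "?B' a = Suc ` {b \<in> ?B. a \<le> b}"
      unfolding B'[OF aS(1)] using aS by (intro arg_cong[where f = "image Suc"]) (auto simp: high_def)
    then show "card (?B' a) = card {b \<in> ?B. a \<le> b}" by (simp add: card_image)
  qed
  have "(\<Sum>a\<in>?S. g (card (?B' a)) (card (?A' a))) =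
      (\<Sum>a\<in>?A. g (card ?B + card {b \<in> ?A. a \<le> b}) (card ?A + 1 - card {b \<in> ?A. a \<le> b})) +
      (\<Sum>a\<in>?B. g (card {b \<in> ?B. a \<le> b}) (card ?A + 1))"
    unfolding sum_sites_split using down upward by simp
  also have "\<dots> = succession g (card ?B) (card ?A)"
    unfolding succession_def
    using sum_rank_ge[of ?B "\<lambda>s. g s (card ?A + 1)"]
      sum_rank_ge[of ?A "\<lambda>t. g (card ?B + t) (card ?A + 1 - t)"] by simp
  finally show ?thesis .
qed

section \<open>Equidistribution of the labels\<close>

lemma avoiders_one: "avoiders d 1 = {id}"
  unfolding avoiders_def by auto

lemma low_one: "low d 1 id = {1}" and high_one: "high d 1 id = {2}"
  by (auto simp: low_def high_def sites_def)

text \<open>Equality of the label distributions is expressed by test functions \<open>g\<close>; quantifying over all of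
  them is what lets the induction pass from \<open>g\<close> to its transform under the succession rule.\<close>

lemma labels_equidistributed:
  assumes "1 \<le> n"
  shows "(\<Sum>\<pi>\<in>avoiders True n. g (card (low True n \<pi>)) (card (high True n \<pi>))) =
    (\<Sum>\<pi>\<in>avoiders False n. g (card (high False n \<pi>)) (card (low False n \<pi>)) :: nat)"
  using assms
proof (induction n arbitrary: g rule: nat_induct_at_least)
  case base
  show ?case unfolding avoiders_one by (simp add: low_one[unfolded id_def] high_one[unfolded id_def] del: One_nat_def)
next
  case (Suc n)
  have "(\<Sum>\<sigma>\<in>avoiders True (Suc n). g (card (low True (Suc n) \<sigma>)) (card (high True (Suc n) \<sigma>))) =
      (\<Sum>\<pi>\<in>avoiders True n. succession g (card (low True n \<pi>)) (card (high True n \<pi>)))"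
    unfolding sum_avoiders_Suc using Suc.hyps by (intro sum.cong refl semi_rule)
  also have "\<dots> = (\<Sum>\<pi>\<in>avoiders False n. succession g (card (high False n \<pi>)) (card (low False n \<pi>)))"
    by (rule Suc.IH)
  also have "\<dots> = (\<Sum>\<sigma>\<in>avoiders False (Suc n).
      g (card (high False (Suc n) \<sigma>)) (card (low False (Suc n) \<sigma>)))"
    unfolding sum_avoiders_Suc using Suc.hyps by (intro sum.cong refl plane_rule[symmetric])
  finally show ?case .
qed

theorem corollary6:
  fixes n :: nat
  assumes "n \<ge> 1"
  shows "SB n = card {\<pi>. plane_perm n \<pi>}"
  using labels_equidistributed[OF assms, of "\<lambda>_ _. 1"]
  by (simp add: SB_def semi_baxter_avoiders plane_perm_avoiders)

end
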